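(* Let $1 \leq p < \infty$, let $f \in L^p(\mathbb{R})$, and let $x_0\in\mathbb{R}$. If $f$ is real analytic in a neighborhood of $x_0$, then its Hilbert transform $Hf$ is also real analytic in a neighborhood of $x_0$.
   Context: For $f \in L^p(\mathbb{R})$, $1 \leq p<\infty$, the Hilbert transform of $f$ is defined (for a.e. $x$) as the principal value $$Hf(x) = p.v.\,\frac{1}{\pi}\int_{-\infty}^{\infty}\frac{f(t)}{x-t}\,dt := \lim_{\epsilon\to 0}\frac{1}{\pi}\int_{|x-t|>\epsilon}\frac{f(t)}{x-t}\,dt.$$ *)

theory Defs
  imports "HOL-Analysis.Analysis"
begin

text \<open>The set of functions representing elements of $L^p$ of the real line, for real exponents
  $p > 0$; functions equal almost everywhere are not identified.\<close>

definition Lp_functions :: "real \<Rightarrow> (real \<Rightarrow> 'a::real_normed_vector) set" where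
  "Lp_functions p =
     {f. f \<in> borel_measurable lebesgue \<and> integrable lebesgue (\<lambda>x. norm (f x) powr p)}"

definition truncated_hilbert ::
    "(real \<Rightarrow> 'a::{banach, second_countable_topology}) \<Rightarrow> real \<Rightarrow> real \<Rightarrow> 'a" where
  "truncated_hilbert f x \<epsilon> =
     (1 / pi) *\<^sub>R (LINT t:{t. \<bar>x - t\<bar> > \<epsilon>}|lebesgue. (1 / (x - t)) *\<^sub>R f t)"

text \<open>The principal value need only exist for almost every point, so the function
  \<open>hilbert_transform\<close> below is meaningful at \<open>x\<close> only if \<open>hilbert_transform_exists f x\<close>.\<close>

definition hilbert_transform_exists ::
    "(real \<Rightarrow> 'a::{banach, second_countable_topology}) \<Rightarrow> real \<Rightarrow> bool" where
  "hilbert_transform_exists f x \<longleftrightarrow> (\<exists>l. (truncated_hilbert f x \<longlongrightarrow> l) (at_right 0))"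

definition hilbert_transform ::
    "(real \<Rightarrow> 'a::{banach, second_countable_topology}) \<Rightarrow> real \<Rightarrow> 'a" where
  "hilbert_transform f x = Lim (at_right 0) (truncated_hilbert f x)"

text \<open>As for \<open>analytic_on\<close>, the discs of convergence are not required to lie inside \<open>S\<close>.\<close>

definition real_analytic_on :: "(real \<Rightarrow> 'a::real_normed_vector) \<Rightarrow> real set \<Rightarrow> bool"
    (infixl \<open>(real'_analytic'_on)\<close> 50) where
  "f real_analytic_on S \<longleftrightarrow>
     (\<forall>c\<in>S. \<exists>r>0. \<exists>a. \<forall>x\<in>ball c r. (\<lambda>n. (x - c) ^ n *\<^sub>R a n) sums f x)"

end

theory Submission
  imports Defs
begin

text \<open>Around each point $c$ at which $f(t) = \sum_n a_n (t-c)^n$, split the integral at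
  $|t - c| = \delta$. On the far part $1/(x-t) = -\sum_n (x-c)^n/(t-c)^{n+1}$ may be integrated
  term by term, because $f(t)/(t-c)$ is integrable there by Young's inequality. On the near part
  write $f(t)/(x-t) = f(x)/(x-t) - T(x,t)$ with
  $T(x,t) = \sum_j (x-c)^j \sum_k a_{j+k+1} (t-c)^k$: the first term has principal value
  $f(x)\,(\ln(\delta+x-c) - \ln(\delta-x+c))$, a product of two power series in $x-c$, and the
  second is again integrated term by term.\<close>

section \<open>Termwise integration and removal of the truncation\<close>

text \<open>The factors r^(-n) in the bound turn y^n into the geometric ratio |y|/r < 1, so the L^1
  norms of the terms are summable and dominated convergence for series applies. The far part uses
  the majorant |f(t)|/|t - c| with r = \<delta>, the near part a constant majorant with r =
  \<rho>.\<close>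

lemma set_integral_power_series_sums:
  fixes h :: "nat \<Rightarrow> 'b \<Rightarrow> 'a::{banach, second_countable_topology}" and y r :: real
  assumes A: "A \<in> sets M"
    and h: "\<And>n. set_borel_measurable M A (h n)"
    and W: "set_integrable M A W"
    and bound: "\<And>n t. t \<in> A \<Longrightarrow> norm (h n t) \<le> W t / r ^ n"
    and y: "\<bar>y\<bar> < r"
    and G: "\<And>t. t \<in> A \<Longrightarrow> (\<lambda>n. y ^ n *\<^sub>R h n t) sums G t"
  shows "set_integrable M A G"
    and "(\<lambda>n. y ^ n *\<^sub>R (LINT t:A|M. h n t)) sums (LINT t:A|M. G t)"
proof -
  define q where "q = \<bar>y\<bar> / r"
  have q: "0 \<le> q" "q < 1" using y by (auto simp: q_def)
  let ?g = "\<lambda>n t. indicator A t *\<^sub>R (y ^ n *\<^sub>R h n t)"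
  let ?W = "\<lambda>t. indicator A t *\<^sub>R W t"
  have IW: "integrable M ?W" using W by (simp add: set_integrable_def)
  have le: "norm (?g n t) \<le> q ^ n * ?W t" for n t
  proof (cases "t \<in> A")
    case True
    have "\<bar>y\<bar> ^ n * norm (h n t) \<le> \<bar>y\<bar> ^ n * (W t / r ^ n)"
      using bound[OF True] by (intro mult_left_mono) auto
    then show ?thesis using True by (simp add: q_def power_divide power_abs)
  qed auto
  have meas: "?g n \<in> borel_measurable M" for n
    using borel_measurable_scaleR[OF borel_measurable_const[of "y ^ n"] h[of n, unfolded set_borel_measurable_def]]
    by (simp add: mult.commute)
  have Ig: "integrable M (?g n)" for n
    by (rule Bochner_Integration.integrable_bound[OF integrable_mult_right[OF IW, of "q ^ n"] meas])
       (intro AE_I2 order_trans[OF le], simp only: real_norm_def abs_ge_self)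
  have sq: "summable (\<lambda>n. q ^ n)" using q by (simp add: summable_geometric)
  have sn: "summable (\<lambda>n. norm (?g n t))" for t
    by (rule summable_comparison_test[OF _ summable_mult2[OF sq, of "?W t"]]) (use le in auto)
  have si: "summable (\<lambda>n. LINT t|M. norm (?g n t))"
  proof (rule summable_comparison_test[OF _ summable_mult2[OF sq, of "LINT t|M. ?W t"]], intro exI allI impI)
    fix n
    have "(LINT t|M. norm (?g n t)) \<le> (LINT t|M. q ^ n * ?W t)"
      using le by (intro integral_mono integrable_norm Ig integrable_mult_right IW) auto
    then show "norm (LINT t|M. norm (?g n t)) \<le> q ^ n * (LINT t|M. ?W t)"
      by (simp add: integral_nonneg_AE)
  qed
  have eq: "(\<Sum>n. ?g n t) = indicator A t *\<^sub>R G t" for t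
    using G[of t] by (cases "t \<in> A") (auto simp: sums_iff)
  have n: "AE t in M. summable (\<lambda>n. norm (?g n t))" using sn by blast
  show "set_integrable M A G"
    using integrable_suminf[OF Ig n si] unfolding eq set_integrable_def .
  have "integral\<^sup>L M (?g n) = y ^ n *\<^sub>R (LINT t:A|M. h n t)" for n
    unfolding set_lebesgue_integral_def integral_scaleR_right[symmetric]
    by (simp add: mult.commute)
  then show "(\<lambda>n. y ^ n *\<^sub>R (LINT t:A|M. h n t)) sums (LINT t:A|M. G t)"
    using sums_integral[OF Ig n si] unfolding eq set_lebesgue_integral_def by simp
qed

text \<open>Dominated convergence with majorant |g|: the indicators of the truncated sets tend to 1
  at every t \<noteq> x, and {x} is null. The limit is taken along sequences because dominated
  convergence concerns sequences.\<close>

lemma truncated_set_integral_tendsto: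
  fixes g :: "real \<Rightarrow> 'a::{banach, second_countable_topology}"
  assumes A: "A \<in> sets lebesgue" and g: "set_integrable lebesgue A g"
  shows "((\<lambda>\<epsilon>. LINT t:A \<inter> {t. \<bar>x - t\<bar> > \<epsilon>}|lebesgue. g t) \<longlongrightarrow> (LINT t:A|lebesgue. g t)) (at_right 0)"
  unfolding tendsto_at_iff_sequentially comp_def
proof (intro allI impI)
  fix X :: "nat \<Rightarrow> real"
  assume "\<forall>i. X i \<in> {0<..} - {0}" and X: "X \<longlonglongrightarrow> 0"
  let ?g = "\<lambda>t. indicator A t *\<^sub>R g t"
  have Ig: "integrable lebesgue ?g" using g by (simp add: set_integrable_def)
  have eq: "indicator (A \<inter> B) t *\<^sub>R g t = indicator B t *\<^sub>R ?g t" for B t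
    by (auto simp: indicator_def)
  have S: "{t. \<bar>x - t\<bar> > e} \<in> sets lebesgue" for e
    by (rule sets_completionI_sets) (simp, measurable)
  show "(\<lambda>i. LINT t:A \<inter> {t. \<bar>x - t\<bar> > X i}|lebesgue. g t) \<longlonglongrightarrow> (LINT t:A|lebesgue. g t)"
    unfolding set_lebesgue_integral_def eq
  proof (rule integral_dominated_convergence)
    show "?g \<in> borel_measurable lebesgue" by (rule borel_measurable_integrable[OF Ig])
    show "integrable lebesgue (\<lambda>t. norm (?g t))" by (rule integrable_norm[OF Ig])
    show "(\<lambda>t. indicator {t. \<bar>x - t\<bar> > X i} t *\<^sub>R ?g t) \<in> borel_measurable lebesgue" for i
      by (intro borel_measurable_scaleR borel_measurable_indicator S borel_measurable_const borel_measurable_integrable[OF Ig])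
    show "AE t in lebesgue. norm (indicator {t. \<bar>x - t\<bar> > X i} t *\<^sub>R ?g t) \<le> norm (?g t)" for i
      by (auto simp: indicator_def)
    have "AE t in lebesgue. t \<noteq> x"
      using AE_lborel_singleton[of x] by (rule AE_completion)
    then show "AE t in lebesgue. (\<lambda>i. indicator {t. \<bar>x - t\<bar> > X i} t *\<^sub>R ?g t) \<longlonglongrightarrow> ?g t"
    proof eventually_elim
      case (elim t)
      then have "eventually (\<lambda>i. X i < \<bar>x - t\<bar>) sequentially"
        using X by (intro order_tendstoD) auto
      then have "eventually (\<lambda>i. indicator {t. \<bar>x - t\<bar> > X i} t *\<^sub>R ?g t = ?g t) sequentially"
        by eventually_elim simp
      then show ?case by (rule tendsto_eventually)
    qed
  qed
qed

section \<open>Integrals of the kernel near and away from its singularity\<close>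

text \<open>The antiderivatives are -ln(x - t) to the left of x and -ln(t - x) to the right. Their
  values at the cut points are -ln \<epsilon> and ln \<epsilon>, which cancel by symmetry; hence the
  result does not depend on \<epsilon>.\<close>

lemma set_integral_truncated_kernel:
  fixes a b x \<epsilon> :: real
  assumes e: "0 < \<epsilon>" "\<epsilon> < x - a" "\<epsilon> < b - x"
  defines "N \<equiv> {a..b} \<inter> {t. \<bar>x - t\<bar> > \<epsilon>}"
  shows "set_integrable lebesgue N (\<lambda>t. 1 / (x - t))"
    and "(LINT t:N|lebesgue. 1 / (x - t)) = ln (x - a) - ln (b - x)"
proof -
  have N: "N \<in> sets lebesgue"
    unfolding N_def by (rule sets_completionI_sets) (simp, measurable)
  have c: "set_integrable lebesgue {a..b} (\<lambda>t. 1 / \<epsilon>)"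
    by (intro absolutely_integrable_continuous_real continuous_intros)
  show I: "set_integrable lebesgue N (\<lambda>t. 1 / (x - t))"
  proof (rule set_integrable_bound)
    show "set_integrable lebesgue N (\<lambda>t. 1 / \<epsilon>)"
      by (rule set_integrable_subset[OF c N]) (auto simp: N_def)
    have "(\<lambda>t. 1 / (x - t)) \<in> borel_measurable lebesgue"
      by (rule measurable_completion) measurable
    then show "set_borel_measurable lebesgue N (\<lambda>t. 1 / (x - t))"
      unfolding set_borel_measurable_def using N
      by (intro borel_measurable_scaleR borel_measurable_indicator)
    show "AE t in lebesgue. t \<in> N \<longrightarrow> norm (1 / (x - t)) \<le> norm (1 / \<epsilon>)"
      using e by (auto simp: N_def intro!: AE_I2 divide_left_mono)
  qed
  have 1: "((\<lambda>t. 1 / (x - t)) has_integral (- ln (x - (x - \<epsilon>)) - (- ln (x - a)))) {a..x - \<epsilon>}"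
    using e by (intro fundamental_theorem_of_calculus)
      (auto intro!: derivative_eq_intros simp: divide_simps simp flip: has_real_derivative_iff_has_vector_derivative)
  have 2: "((\<lambda>t. 1 / (x - t)) has_integral (- ln (b - x) - (- ln (x + \<epsilon> - x)))) {x + \<epsilon>..b}"
    using e by (intro fundamental_theorem_of_calculus)
      (auto intro!: derivative_eq_intros simp: divide_simps simp flip: has_real_derivative_iff_has_vector_derivative)
  have "{a..x - \<epsilon>} \<inter> {x + \<epsilon>..b} = {}" using e by auto
  with has_integral_Un[OF 1 2]
  have "((\<lambda>t. 1 / (x - t)) has_integral (ln (x - a) - ln (b - x))) ({a..x - \<epsilon>} \<union> {x + \<epsilon>..b})"
    by simp
  \<comment> \<open>The truncation is strict, so \<open>N\<close> differs from the two closed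
    intervals only by the points x - \<epsilon> and x + \<epsilon>.\<close>
  then have "((\<lambda>t. 1 / (x - t)) has_integral (ln (x - a) - ln (b - x))) N"
    by (subst has_integral_spike_set_eq[where T = "{a..x - \<epsilon>} \<union> {x + \<epsilon>..b}"])
      (rule negligible_subset[OF negligible_finite[of "{x - \<epsilon>, x + \<epsilon>}"]]; use e in \<open>force simp: N_def\<close>)+
  then show "(LINT t:N|lebesgue. 1 / (x - t)) = ln (x - a) - ln (b - x)"
    using set_lebesgue_integral_eq_integral(2)[OF I] by (simp add: integral_unique)
qed

lemma integrable_powr_outside_ball:
  fixes c \<delta> q :: real
  assumes "\<delta> > 0" "q > 1"
  shows "set_integrable lebesgue {t. \<delta> < \<bar>t - c\<bar>} (\<lambda>t. \<bar>t - c\<bar> powr - q)"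
proof -
  let ?g = "\<lambda>u. indicator {\<delta>..} u *\<^sub>R (u powr - q)"
  have "(\<lambda>u. u powr - q) integrable_on {\<delta>..}"
    using has_integral_powr_to_inf[of "-q" \<delta>] assms by (auto simp: integrable_on_def)
  then have "(\<lambda>u. u powr - q) absolutely_integrable_on {\<delta>..}"
    by (rule nonnegative_absolutely_integrable_1) auto
  then have "integrable lebesgue ?g" by (simp add: set_integrable_def)
  then have g: "integrable lborel ?g"
    by (subst (asm) integrable_completion) auto
  \<comment> \<open>A translate and a reflected translate of the half-line function: for |t - c| >
    \<delta> exactly one of the two summands is nonzero, and it equals |t - c|^(-q).\<close>
  have "integrable lborel (\<lambda>t. ?g (- c + 1 * t) + ?g (c + (-1) * t))"
    by (intro Bochner_Integration.integrable_add lborel_integrable_real_affine g) auto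
  then have "integrable lebesgue (\<lambda>t. ?g (- c + 1 * t) + ?g (c + (-1) * t))"
    by (subst integrable_completion) auto
  then have "set_integrable lebesgue UNIV (\<lambda>t. ?g (- c + 1 * t) + ?g (c + (-1) * t))"
    by (simp add: set_integrable_def)
  have S: "{t. \<delta> < \<bar>t - c\<bar>} \<in> sets lebesgue"
    by (rule sets_completionI_sets) (simp, measurable)
  have "set_integrable lebesgue {t. \<delta> < \<bar>t - c\<bar>} (\<lambda>t. ?g (- c + 1 * t) + ?g (c + (-1) * t))"
    by (rule set_integrable_subset[OF _ S]) (fact, auto)
  then show ?thesis
    by (rule set_integrable_cong[THEN iffD1, rotated -1])
       (use assms in \<open>auto simp: indicator_def abs_if\<close>)
qed

lemma Lp_kernel_integrable:
  fixes f :: "real \<Rightarrow> 'a::{banach, second_countable_topology}" and c \<delta> p :: real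
  assumes p: "1 \<le> p" and f: "f \<in> Lp_functions p" and d: "\<delta> > 0"
  shows "set_integrable lebesgue {t. \<delta> < \<bar>t - c\<bar>} (\<lambda>t. norm (f t) / \<bar>t - c\<bar>)"
proof -
  let ?S = "{t. \<delta> < \<bar>t - c\<bar>}"
  have S: "?S \<in> sets lebesgue"
    by (rule sets_completionI_sets) (simp, measurable)
  have fm: "f \<in> borel_measurable lebesgue" and fi: "integrable lebesgue (\<lambda>x. norm (f x) powr p)"
    using f by (auto simp: Lp_functions_def)
  have "set_integrable lebesgue UNIV (\<lambda>t. norm (f t) powr p)"
    using fi by (simp add: set_integrable_def)
  then have fS: "set_integrable lebesgue ?S (\<lambda>t. norm (f t) powr p)"
    by (rule set_integrable_subset[OF _ S]) auto
  have "(\<lambda>t. \<bar>t - c\<bar>) \<in> borel_measurable lebesgue"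
    by (rule measurable_completion) measurable
  then have m: "set_borel_measurable lebesgue ?S (\<lambda>t. norm (f t) / \<bar>t - c\<bar>)"
    unfolding set_borel_measurable_def using S fm
    by (intro borel_measurable_scaleR borel_measurable_indicator borel_measurable_divide borel_measurable_norm) auto
  show ?thesis
  proof (cases "p = 1")
    case True
    \<comment> \<open>For p = 1 the conjugate exponent is infinite; the kernel is simply bounded by
      1/\<delta> on the set.\<close>
    have "set_integrable lebesgue ?S (\<lambda>t. 1 / \<delta> * norm (f t) powr p)"
      using fS by (simp add: set_integrable_def)
    then show ?thesis
    proof (rule set_integrable_bound[OF _ m], intro AE_I2 impI)
      fix t assume "t \<in> ?S"
      then have "norm (f t) / \<bar>t - c\<bar> \<le> norm (f t) / \<delta>"
        using d by (intro divide_left_mono) auto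
      then show "norm (norm (f t) / \<bar>t - c\<bar>) \<le> norm (1 / \<delta> * norm (f t) powr p)"
        using True d by simp
    qed
  next
    case False
    with p have p1: "p > 1" by simp
    \<comment> \<open>The exponent conjugate to p. Since q > 1, |t - c|^(-q) is integrable at
      infinity, so both terms of Young's inequality for |f(t)| and 1/|t - c| are integrable.\<close>
    define q where "q = p / (p - 1)"
    have q: "q > 1" using p1 by (simp add: q_def field_simps)
    have "set_integrable lebesgue ?S (\<lambda>t. norm (f t) powr p + \<bar>t - c\<bar> powr - q)"
      by (rule set_integral_add(1)[OF fS integrable_powr_outside_ball[OF d q]])
    then show ?thesis
    proof (rule set_integrable_bound[OF _ m], intro AE_I2 impI)
      fix t assume t: "t \<in> ?S"
      define u where "u = norm (f t)"
      define v where "v = 1 / \<bar>t - c\<bar>"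
      have v: "v > 0" using t d by (auto simp: v_def)
      have vq: "\<bar>t - c\<bar> powr - q = v powr q"
        by (simp add: v_def powr_minus_divide powr_divide)
      have pq: "1 / p + 1 / q = 1" using p1 by (simp add: q_def field_simps)
      have "u * v \<le> u powr p / p + v powr q / q"
        using v p1 q pq by (intro Youngs_inequality) (auto simp: u_def)
      also have "\<dots> \<le> u powr p + v powr q"
        using p1 q by (intro add_mono) (auto simp: divide_le_eq mult_le_cancel_left1)
      finally show "norm (norm (f t) / \<bar>t - c\<bar>) \<le> norm (norm (f t) powr p + \<bar>t - c\<bar> powr - q)"
        unfolding vq by (simp add: u_def v_def)
    qed
  qed
qed

section \<open>Tails of a power series and its difference quotient\<close>

text \<open>This is the remainder from index j on, already divided by s^j. Shifting the index
  instead of dividing makes it meaningful at s = 0, where its value is \<open>a j\<close>.\<close>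

definition power_series_tail :: "(nat \<Rightarrow> 'a::real_normed_vector) \<Rightarrow> nat \<Rightarrow> real \<Rightarrow> 'a" where
  "power_series_tail a j s = (\<Sum>k. s ^ k *\<^sub>R a (j + k))"

context
  fixes a :: "nat \<Rightarrow> 'a::banach" and M \<rho> :: real
  assumes coeff_bound: "\<And>n. norm (a n) \<le> M / \<rho> ^ n" and rho_pos: "\<rho> > 0"
begin

lemma norm_tail_term_le: "norm (s ^ k *\<^sub>R a (j + k)) \<le> M / \<rho> ^ j * (\<bar>s\<bar> / \<rho>) ^ k"
proof -
  have "norm (s ^ k *\<^sub>R a (j + k)) \<le> \<bar>s\<bar> ^ k * (M / \<rho> ^ (j + k))"
    unfolding norm_scaleR power_abs by (intro mult_left_mono coeff_bound) simp
  also have "\<dots> = M / \<rho> ^ j * (\<bar>s\<bar> / \<rho>) ^ k"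
    by (simp add: power_add power_divide)
  finally show ?thesis .
qed

lemma tail_majorant_sums:
  assumes "\<bar>s\<bar> < \<rho>"
  shows "(\<lambda>k. M / \<rho> ^ j * (\<bar>s\<bar> / \<rho>) ^ k) sums (M / \<rho> ^ j * (1 / (1 - \<bar>s\<bar> / \<rho>)))"
  using assms rho_pos by (intro sums_mult geometric_sums) auto

lemma summable_norm_power_series_tail:
  assumes "\<bar>s\<bar> < \<rho>"
  shows "summable (\<lambda>k. norm (s ^ k *\<^sub>R a (j + k)))"
  by (rule summable_comparison_test[OF _ sums_summable[OF tail_majorant_sums[OF assms, of j]]])
     (intro exI[of _ 0] allI impI, simp only: real_norm_def abs_norm_cancel norm_tail_term_le)

lemma power_series_tail_sums:
  assumes "\<bar>s\<bar> < \<rho>"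
  shows "(\<lambda>k. s ^ k *\<^sub>R a (j + k)) sums power_series_tail a j s"
  unfolding power_series_tail_def
  by (rule summable_sums[OF summable_norm_cancel[OF summable_norm_power_series_tail[OF assms]]])

text \<open>Staying within half the radius keeps the geometric factor 1/(1 - |s|/\<rho>) at most 2.
  The resulting bound is uniform in s, which provides the constant majorant for integrating over the
  near interval.\<close>

lemma norm_power_series_tail_le:
  assumes "\<bar>s\<bar> \<le> \<rho> / 2"
  shows "norm (power_series_tail a j s) \<le> 2 * M / \<rho> ^ j"
proof -
  have s: "\<bar>s\<bar> < \<rho>" using assms rho_pos by simp
  have M: "0 \<le> M / \<rho> ^ j" using norm_ge_zero coeff_bound by (rule order_trans)
  have "norm (power_series_tail a j s) \<le> (\<Sum>k. M / \<rho> ^ j * (\<bar>s\<bar> / \<rho>) ^ k)"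
    unfolding power_series_tail_def
    by (intro norm_suminf_le norm_tail_term_le sums_summable[OF tail_majorant_sums[OF s]])
  also have "\<dots> = M / \<rho> ^ j * (1 / (1 - \<bar>s\<bar> / \<rho>))"
    using tail_majorant_sums[OF s] by (simp add: sums_iff)
  also have "\<dots> \<le> M / \<rho> ^ j * 2"
    using assms rho_pos M by (intro mult_left_mono) (auto simp: field_simps)
  finally show ?thesis by (simp add: mult.commute)
qed

lemma power_series_tail_Suc:
  assumes "\<bar>s\<bar> < \<rho>"
  shows "power_series_tail a j s = a j + s *\<^sub>R power_series_tail a (Suc j) s"
proof -
  have "(\<lambda>k. s *\<^sub>R (s ^ k *\<^sub>R a (Suc j + k))) sums (s *\<^sub>R power_series_tail a (Suc j) s)"
    by (intro sums_scaleR_right power_series_tail_sums assms)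
  then have "(\<lambda>k. s ^ Suc k *\<^sub>R a (j + Suc k)) sums (s *\<^sub>R power_series_tail a (Suc j) s)"
    by simp
  from sums_Suc[OF this] have "(\<lambda>k. s ^ k *\<^sub>R a (j + k)) sums (s *\<^sub>R power_series_tail a (Suc j) s + a j)"
    by simp
  with power_series_tail_sums[OF assms, of j]
  have "power_series_tail a j s = s *\<^sub>R power_series_tail a (Suc j) s + a j"
    by (rule sums_unique2)
  then show ?thesis by (rule trans[OF _ add.commute])
qed

text \<open>Since $F_j = a_j + s F_{j+1}$ for the tails $F_j$ at $s$, multiplying the series
  by $s$ shifts it, which gives the quotient without rearranging a double series.\<close>

lemma power_series_difference_quotient:
  assumes y: "\<bar>y\<bar> < \<rho>" and s: "\<bar>s\<bar> \<le> \<rho> / 2"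
  obtains T where "(\<lambda>j. y ^ j *\<^sub>R power_series_tail a (Suc j) s) sums T"
    and "(s - y) *\<^sub>R T = power_series_tail a 0 s - power_series_tail a 0 y"
proof -
  let ?h = "\<lambda>j. power_series_tail a j s"
  have s': "\<bar>s\<bar> < \<rho>" using s rho_pos by simp
  have "summable (\<lambda>j. y ^ j *\<^sub>R ?h (Suc j))"
  proof (rule summable_comparison_test[OF _ summable_mult[of "\<lambda>j. (\<bar>y\<bar> / \<rho>) ^ j" "2 * M / \<rho>"]], intro exI allI impI)
    show "summable (\<lambda>j. (\<bar>y\<bar> / \<rho>) ^ j)" using y rho_pos by (simp add: summable_geometric)
    show "norm (y ^ j *\<^sub>R ?h (Suc j)) \<le> 2 * M / \<rho> * (\<bar>y\<bar> / \<rho>) ^ j" for j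
    proof -
      have "norm (y ^ j *\<^sub>R ?h (Suc j)) \<le> \<bar>y\<bar> ^ j * (2 * M / \<rho> ^ Suc j)"
        unfolding norm_scaleR power_abs by (intro mult_left_mono norm_power_series_tail_le s) simp
      also have "\<dots> = 2 * M / \<rho> * (\<bar>y\<bar> / \<rho>) ^ j"
        by (simp add: power_divide)
      finally show ?thesis .
    qed
  qed
  then obtain T where T: "(\<lambda>j. y ^ j *\<^sub>R ?h (Suc j)) sums T"
    by (auto simp: summable_def)
  \<comment> \<open>With F_j the tails at s, the sum of y^j F_j is found in two ways: shifting the
    index gives y T + F_0, while the recursion for F_j gives the original series at y plus s T.
    Comparing them isolates (s - y) T.\<close>
  have "(\<lambda>j. y *\<^sub>R (y ^ j *\<^sub>R ?h (Suc j))) sums (y *\<^sub>R T)"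
    by (rule sums_scaleR_right[OF T])
  then have "(\<lambda>j. y ^ Suc j *\<^sub>R ?h (Suc j)) sums (y *\<^sub>R T)" by simp
  from sums_Suc[OF this] have "(\<lambda>j. y ^ j *\<^sub>R ?h j) sums (y *\<^sub>R T + ?h 0)" by simp
  from sums_diff[OF this power_series_tail_sums[OF y, of 0]]
  have "(\<lambda>j. y ^ j *\<^sub>R (?h j - a j)) sums (y *\<^sub>R T + ?h 0 - power_series_tail a 0 y)"
    by (simp add: scaleR_diff_right)
  moreover have "y ^ j *\<^sub>R (?h j - a j) = s *\<^sub>R (y ^ j *\<^sub>R ?h (Suc j))" for j
    using power_series_tail_Suc[OF s', of j] by simp
  ultimately have "s *\<^sub>R T = y *\<^sub>R T + ?h 0 - power_series_tail a 0 y"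
    using sums_scaleR_right[OF T, of s] by (simp add: sums_unique2)
  then have "(s - y) *\<^sub>R T = ?h 0 - power_series_tail a 0 y"
    by (simp only: scaleR_diff_left diff_eq_eq) (simp add: algebra_simps)
  with T show ?thesis by (rule that)
qed

end

text \<open>Convergence at the single point \<rho> forces the terms to tend to zero, so they are
  bounded; dividing by \<rho>^n gives the estimate.\<close>

lemma convergent_power_series_coeff_bound:
  fixes a :: "nat \<Rightarrow> 'a::real_normed_vector"
  assumes "summable (\<lambda>n. \<rho> ^ n *\<^sub>R a n)" "\<rho> > 0"
  obtains M where "\<And>n. norm (a n) \<le> M / \<rho> ^ n"
proof -
  have "Bseq (\<lambda>n. \<rho> ^ n *\<^sub>R a n)"
    by (intro convergent_imp_Bseq convergentI[OF summable_LIMSEQ_zero[OF assms(1)]])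
  then obtain M where "\<And>n. norm (\<rho> ^ n *\<^sub>R a n) \<le> M" by (auto simp: Bseq_def)
  then show ?thesis using assms(2) by (intro that[of M]) (simp add: field_simps)
qed

section \<open>The power series of the logarithmic term\<close>

text \<open>Embedding the real factor by \<open>of_real\<close> places both series in one algebra,
  where the Cauchy product applies; y^i y^(n-i) = y^n then collects the powers.\<close>

lemma Cauchy_product_power_series_sums:
  fixes l :: "nat \<Rightarrow> real" and a :: "nat \<Rightarrow> 'a::{real_normed_algebra_1, banach}"
  assumes l: "(\<lambda>n. y ^ n * l n) sums L" "summable (\<lambda>n. norm (y ^ n * l n))"
    and a: "(\<lambda>n. y ^ n *\<^sub>R a n) sums F" "summable (\<lambda>n. norm (y ^ n *\<^sub>R a n))"
  shows "(\<lambda>n. y ^ n *\<^sub>R (\<Sum>i\<le>n. l i *\<^sub>R a (n - i))) sums (L *\<^sub>R F)"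
proof -
  have "(\<lambda>n. of_real (y ^ n * l n) :: 'a) sums of_real L"
    by (intro sums_of_real l)
  moreover have "summable (\<lambda>n. norm (of_real (y ^ n * l n) :: 'a))"
    using l(2) by (simp only: norm_of_real real_norm_def)
  ultimately have "(\<lambda>n. \<Sum>i\<le>n. of_real (y ^ i * l i) * (y ^ (n - i) *\<^sub>R a (n - i))) sums (of_real L * F)"
    using Cauchy_product_sums[of "\<lambda>n. of_real (y ^ n * l n) :: 'a" "\<lambda>n. y ^ n *\<^sub>R a n"] a
    by (simp add: sums_iff)
  moreover have "(\<Sum>i\<le>n. of_real (y ^ i * l i) * (y ^ (n - i) *\<^sub>R a (n - i)))
      = y ^ n *\<^sub>R (\<Sum>i\<le>n. l i *\<^sub>R a (n - i))" for n
    unfolding scaleR_sum_right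
  proof (intro sum.cong refl)
    fix i assume "i \<in> {..n}"
    then have "y ^ i * y ^ (n - i) = y ^ n" by (simp flip: power_add)
    then have "y ^ i * l i * y ^ (n - i) = y ^ n * l i" by (simp add: mult.commute mult.left_commute)
    then show "of_real (y ^ i * l i) * (y ^ (n - i) *\<^sub>R a (n - i)) = y ^ n *\<^sub>R l i *\<^sub>R a (n - i)"
      unfolding scaleR_conv_of_real[symmetric] scaleR_scaleR by (rule arg_cong)
  qed
  ultimately show ?thesis by (simp add: scaleR_conv_of_real)
qed

text \<open>With u = y/\<delta> the difference is ln(1 + u) - ln(1 - u), and in the two logarithm
  series the even powers cancel. The coefficient \<open>l 0\<close> is 0/0, which is 0 by
  convention, as it should be.\<close>

lemma ln_ratio_power_series_sums:
  fixes y \<delta> :: real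
  assumes "\<bar>y\<bar> < \<delta>"
  defines "l \<equiv> \<lambda>n. (1 - (-1) ^ n) / (real n * \<delta> ^ n)"
  shows "(\<lambda>n. y ^ n * l n) sums (ln (\<delta> + y) - ln (\<delta> - y))"
    and "summable (\<lambda>n. norm (y ^ n * l n))"
proof -
  have d: "\<delta> > 0" using assms by linarith
  define u where "u = y / \<delta>"
  have u: "\<bar>u\<bar> < 1" using assms d by (simp add: u_def)
  have "(\<lambda>n. - ((- u) ^ n) / real n - - ((- (- u)) ^ n) / real n) sums (ln (1 + u) - ln (1 + - u))"
    using u by (intro sums_diff ln_series') auto
  moreover have "- ((- u) ^ n) / real n - - ((- (- u)) ^ n) / real n = y ^ n * l n" for n
    by (cases "even n") (auto simp: u_def l_def power_divide)
  moreover have "ln (1 + u) - ln (1 + - u) = ln (\<delta> + y) - ln (\<delta> - y)"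
  proof -
    have "1 + u = (\<delta> + y) / \<delta>" "1 + - u = (\<delta> - y) / \<delta>" using d by (auto simp: u_def field_simps)
    moreover have "\<delta> + y > 0" "\<delta> - y > 0" using assms by linarith+
    ultimately show ?thesis using d by (simp add: ln_div)
  qed
  ultimately show "(\<lambda>n. y ^ n * l n) sums (ln (\<delta> + y) - ln (\<delta> - y))" by simp
  show "summable (\<lambda>n. norm (y ^ n * l n))"
  proof (rule summable_comparison_test[OF _ summable_mult[of "\<lambda>n. \<bar>u\<bar> ^ n" 2]], intro exI allI impI)
    show "summable (\<lambda>n. \<bar>u\<bar> ^ n)" using u by (simp add: summable_geometric)
    show "norm (norm (y ^ n * l n)) \<le> 2 * \<bar>u\<bar> ^ n" for n
    proof (cases "n = 0")
      case False
      \<comment> \<open>The numerator is 0 or 2 and n is at least 1, hence the constant 2 in the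
        geometric majorant.\<close>
      have "\<bar>1 - (-1 :: real) ^ n\<bar> \<le> 2" by (cases "even n") auto
      then have "\<bar>1 - (-1 :: real) ^ n\<bar> / real n \<le> 2 / 1"
        using False by (intro frac_le) auto
      from mult_right_mono[OF this, of "\<bar>u\<bar> ^ n"] show ?thesis
        using d by (simp add: l_def u_def abs_mult power_abs power_divide mult_ac)
    qed (simp add: l_def)
  qed
qed

section \<open>Expansion of the far and near parts of the integral\<close>

text \<open>As |x - c| < \<delta> < |t - c|, the kernel is a geometric series in (x - c)/(t - c).
  The coefficients are the integrals of -f(t)/(t - c)^(n+1) over \<open>S\<close>, independent of
  x.\<close>

lemma far_kernel_power_series:
  fixes f :: "real \<Rightarrow> 'a::{banach, second_countable_topology}" and c \<delta> p :: real
  assumes p: "1 \<le> p" and f: "f \<in> Lp_functions p" and d: "\<delta> > 0"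
  defines "S \<equiv> {t. \<delta> < \<bar>t - c\<bar>}"
  obtains b where
    "\<And>x. \<bar>x - c\<bar> < \<delta> \<Longrightarrow> set_integrable lebesgue S (\<lambda>t. (1 / (x - t)) *\<^sub>R f t)"
    "\<And>x. \<bar>x - c\<bar> < \<delta> \<Longrightarrow>
       (\<lambda>n. (x - c) ^ n *\<^sub>R b n) sums (LINT t:S|lebesgue. (1 / (x - t)) *\<^sub>R f t)"
proof -
  let ?h = "\<lambda>n t. (- 1 / (t - c) ^ Suc n) *\<^sub>R f t"
  have S: "S \<in> sets lebesgue"
    unfolding S_def by (rule sets_completionI_sets) (simp, measurable)
  have hm: "set_borel_measurable lebesgue S (?h n)" for n
  proof -
    have "(\<lambda>t. - 1 / (t - c) ^ Suc n) \<in> borel_measurable lebesgue"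
      by (rule measurable_completion) measurable
    then show ?thesis
      using f S unfolding set_borel_measurable_def Lp_functions_def
      by (intro borel_measurable_scaleR borel_measurable_indicator) auto
  qed
  \<comment> \<open>One of the n + 1 factors 1/|t - c| stays with f to make it integrable; the other
    n are bounded by 1/\<delta> each.\<close>
  have bound: "norm (?h n t) \<le> norm (f t) / \<bar>t - c\<bar> / \<delta> ^ n" if "t \<in> S" for n t
  proof -
    have "\<delta> ^ n \<le> \<bar>t - c\<bar> ^ n" using that d by (intro power_mono) (auto simp: S_def)
    then have "norm (f t) / \<bar>t - c\<bar> / \<bar>t - c\<bar> ^ n \<le> norm (f t) / \<bar>t - c\<bar> / \<delta> ^ n"
      using that d by (intro divide_left_mono mult_pos_pos zero_less_power) (auto simp: S_def)
    then show ?thesis by (simp add: power_abs abs_mult)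
  qed
  have sums: "(\<lambda>n. (x - c) ^ n *\<^sub>R ?h n t) sums ((1 / (x - t)) *\<^sub>R f t)"
    if x: "\<bar>x - c\<bar> < \<delta>" and t: "t \<in> S" for x t
  proof -
    have "\<bar>x - c\<bar> < \<bar>t - c\<bar>" and tc: "t - c \<noteq> 0" using x t d by (auto simp: S_def)
    then have "norm ((x - c) / (t - c)) < 1" by simp
    from sums_mult[OF geometric_sums[OF this], of "- 1 / (t - c)"]
    have "(\<lambda>n. - 1 / (t - c) * ((x - c) / (t - c)) ^ n) sums (- 1 / (t - c) * (1 / (1 - (x - c) / (t - c))))" .
    moreover have "- 1 / (t - c) * (1 / (1 - (x - c) / (t - c))) = 1 / (x - t)"
    proof -
      have "- 1 / v * (1 / (1 - u / v)) = 1 / (u - v)" if "v \<noteq> 0" for u v :: real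
      proof -
        have "1 - u / v = (v - u) / v" using that by (simp add: diff_divide_distrib)
        then have "- 1 / v * (1 / (1 - u / v)) = - (1 / (v - u))" using that by simp
        also have "- (1 / (v - u)) = 1 / (u - v)" by (simp only: minus_divide_right minus_diff_eq)
        finally show ?thesis .
      qed
      from this[OF tc, of "x - c"] show ?thesis by simp
    qed
    moreover have "- 1 / (t - c) * ((x - c) / (t - c)) ^ n = (x - c) ^ n * (- 1 / (t - c) ^ Suc n)" for n
      by (simp add: power_divide)
    ultimately have "(\<lambda>n. (x - c) ^ n * (- 1 / (t - c) ^ Suc n)) sums (1 / (x - t))"
      by (simp only:)
    from sums_scaleR_left[OF this, of "f t"] show ?thesis by simp
  qed
  note W = Lp_kernel_integrable[OF p f d, of c, folded S_def]
  show ?thesis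
  proof (rule that[of "\<lambda>n. LINT t:S|lebesgue. ?h n t"])
    fix x assume x: "\<bar>x - c\<bar> < \<delta>"
    show "set_integrable lebesgue S (\<lambda>t. (1 / (x - t)) *\<^sub>R f t)"
      by (rule set_integral_power_series_sums(1)[OF S hm W bound x sums[OF x]])
    show "(\<lambda>n. (x - c) ^ n *\<^sub>R (LINT t:S|lebesgue. ?h n t)) sums (LINT t:S|lebesgue. (1 / (x - t)) *\<^sub>R f t)"
      by (rule set_integral_power_series_sums(2)[OF S hm W bound x sums[OF x]])
  qed
qed

text \<open>Subtracting f(x)/(x - t) removes the singularity. The condition \<epsilon> < \<delta> -
  |x - c| keeps the excised interval inside the near interval, where the integral of 1/(x - t) is
  independent of \<epsilon>. Integrability is recorded because adding the far part requires
  it.\<close>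

lemma near_kernel_principal_value:
  fixes f :: "real \<Rightarrow> 'a::{real_normed_algebra_1, euclidean_space}" and c \<rho> M :: real
  assumes bound: "\<And>n. norm (a n) \<le> M / \<rho> ^ n" and rho: "\<rho> > 0"
    and f: "\<And>t. \<bar>t - c\<bar> < \<rho> \<Longrightarrow> (\<lambda>n. (t - c) ^ n *\<^sub>R a n) sums f t"
  defines "\<delta> \<equiv> \<rho> / 2"
  defines "N \<equiv> \<lambda>x \<epsilon>. {c - \<delta>..c + \<delta>} \<inter> {t. \<bar>x - t\<bar> > \<epsilon>}"
  obtains b l where
    "\<And>x \<epsilon>. \<lbrakk>\<bar>x - c\<bar> < \<delta>; 0 < \<epsilon>; \<epsilon> < \<delta> - \<bar>x - c\<bar>\<rbrakk> \<Longrightarrow>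
       set_integrable lebesgue (N x \<epsilon>) (\<lambda>t. (1 / (x - t)) *\<^sub>R f t)"
    "\<And>x. \<bar>x - c\<bar> < \<delta> \<Longrightarrow>
       ((\<lambda>\<epsilon>. LINT t:N x \<epsilon>|lebesgue. (1 / (x - t)) *\<^sub>R f t) \<longlongrightarrow> l x) (at_right 0)"
    "\<And>x. \<bar>x - c\<bar> < \<delta> \<Longrightarrow> (\<lambda>n. (x - c) ^ n *\<^sub>R b n) sums l x"
proof -
  let ?A = "{c - \<delta>..c + \<delta>}"
  let ?h = "\<lambda>j t. power_series_tail a (Suc j) (t - c)"
  \<comment> \<open>For t \<noteq> x in the near interval this is the difference quotient (f(t) -
    f(x))/(t - x); as a series in x - c it also has a value at t = x and can be integrated
    termwise.\<close>
  define T where "T = (\<lambda>x t. \<Sum>j. (x - c) ^ j *\<^sub>R ?h j t)"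
  have d: "0 < \<delta>" "\<delta> < \<rho>" using rho by (auto simp: \<delta>_def)
  have A: "?A \<in> sets lebesgue" by simp
  have N_eq: "N x \<epsilon> = ?A \<inter> {t. \<bar>x - t\<bar> > \<epsilon>}" for x \<epsilon>
    by (simp add: N_def)
  have NA: "N x \<epsilon> \<in> sets lebesgue" for x \<epsilon>
    unfolding N_def by (rule sets_completionI_sets) (simp, measurable)
  have tail0: "power_series_tail a 0 (t - c) = f t" if "\<bar>t - c\<bar> < \<rho>" for t
    using power_series_tail_sums[OF bound rho that, of 0] f[OF that] by (simp add: sums_unique2)
  have "(\<lambda>t. ?h j t) \<in> borel_measurable lebesgue" for j
    unfolding power_series_tail_def by (rule measurable_completion) measurable
  then have hm: "set_borel_measurable lebesgue ?A (?h j)" for j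
    unfolding set_borel_measurable_def using A
    by (intro borel_measurable_scaleR borel_measurable_indicator)
  have W: "set_integrable lebesgue ?A (\<lambda>t. 2 * M / \<rho>)"
    by (intro absolutely_integrable_continuous_real continuous_intros)
  have hb: "norm (?h j t) \<le> 2 * M / \<rho> / \<rho> ^ j" if "t \<in> ?A" for j t
  proof -
    have "\<bar>t - c\<bar> \<le> \<rho> / 2" using that unfolding \<delta>_def atLeastAtMost_iff by linarith
    from norm_power_series_tail_le[OF bound rho this, of "Suc j"] show ?thesis by simp
  qed
  have T: "(\<lambda>j. (x - c) ^ j *\<^sub>R ?h j t) sums T x t" "(t - x) *\<^sub>R T x t = f t - f x"
    if x: "\<bar>x - c\<bar> < \<delta>" and t: "t \<in> ?A" for x t
  proof -
    have t': "\<bar>t - c\<bar> \<le> \<rho> / 2" using t unfolding \<delta>_def atLeastAtMost_iff by linarith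
    obtain T' where T': "(\<lambda>j. (x - c) ^ j *\<^sub>R ?h j t) sums T'"
      "(t - c - (x - c)) *\<^sub>R T' = power_series_tail a 0 (t - c) - power_series_tail a 0 (x - c)"
      by (rule power_series_difference_quotient[OF bound rho _ t', of "x - c"]) (use x d in auto)
    moreover have "T x t = T'" using T'(1) by (simp add: T_def sums_iff)
    ultimately show "(\<lambda>j. (x - c) ^ j *\<^sub>R ?h j t) sums T x t" "(t - x) *\<^sub>R T x t = f t - f x"
      using tail0[of t] tail0[of x] x t' d rho by auto
  qed
  have exp: "set_integrable lebesgue ?A (T x)"
    "(\<lambda>n. (x - c) ^ n *\<^sub>R (LINT t:?A|lebesgue. ?h n t)) sums (LINT t:?A|lebesgue. T x t)"
    if x: "\<bar>x - c\<bar> < \<delta>" for x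
    using set_integral_power_series_sums[OF A hm W hb _ T(1)[OF x]] x d by auto
  have I: "set_integrable lebesgue (N x \<epsilon>) (\<lambda>t. (1 / (x - t)) *\<^sub>R f t)"
    "(LINT t:N x \<epsilon>|lebesgue. (1 / (x - t)) *\<^sub>R f t) =
      (ln (\<delta> + (x - c)) - ln (\<delta> - (x - c))) *\<^sub>R f x - (LINT t:N x \<epsilon>|lebesgue. T x t)"
    if x: "\<bar>x - c\<bar> < \<delta>" and e: "0 < \<epsilon>" "\<epsilon> < \<delta> - \<bar>x - c\<bar>" for x \<epsilon>
  proof -
    have e': "\<epsilon> < x - (c - \<delta>)" "\<epsilon> < (c + \<delta>) - x" using e by linarith+
    note K = set_integral_truncated_kernel[OF e(1) e', folded N_eq]
    have K1: "set_integrable lebesgue (N x \<epsilon>) (\<lambda>t. (1 / (x - t)) *\<^sub>R f x)"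
      using K(1) by (intro set_integrable_scaleR_left)
    have K2: "set_integrable lebesgue (N x \<epsilon>) (T x)"
      by (rule set_integrable_subset[OF exp(1)[OF x] NA]) (auto simp: N_def)
    have eq: "(1 / (x - t)) *\<^sub>R f x - T x t = (1 / (x - t)) *\<^sub>R f t" if "t \<in> N x \<epsilon>" for t
    proof -
      have "x - t \<noteq> 0" "t \<in> ?A" using that e by (auto simp: N_def)
      then have "T x t = (1 / (x - t)) *\<^sub>R ((x - t) *\<^sub>R T x t)" by simp
      also have "(x - t) *\<^sub>R T x t = f x - f t"
        using T(2)[OF x \<open>t \<in> ?A\<close>] by (simp add: algebra_simps)
      finally show ?thesis by (simp add: scaleR_diff_right)
    qed
    show "set_integrable lebesgue (N x \<epsilon>) (\<lambda>t. (1 / (x - t)) *\<^sub>R f t)"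
      by (rule iffD1[OF set_integrable_cong[OF refl refl eq] set_integral_diff(1)[OF K1 K2]])
    have "(LINT t:N x \<epsilon>|lebesgue. (1 / (x - t)) *\<^sub>R f t)
        = (LINT t:N x \<epsilon>|lebesgue. (1 / (x - t)) *\<^sub>R f x - T x t)"
      by (rule set_lebesgue_integral_cong[OF NA]) (intro allI impI eq[symmetric])
    also have "\<dots> = (LINT t:N x \<epsilon>|lebesgue. (1 / (x - t)) *\<^sub>R f x) - (LINT t:N x \<epsilon>|lebesgue. T x t)"
      by (rule set_integral_diff(2)[OF K1 K2])
    also have "(LINT t:N x \<epsilon>|lebesgue. (1 / (x - t)) *\<^sub>R f x) = (LINT t:N x \<epsilon>|lebesgue. 1 / (x - t)) *\<^sub>R f x"
      using integral_scaleR_left[OF K(1)[unfolded set_integrable_def], of "f x"]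
      by (simp add: set_lebesgue_integral_def)
    also have "(LINT t:N x \<epsilon>|lebesgue. 1 / (x - t)) = ln (\<delta> + (x - c)) - ln (\<delta> - (x - c))"
      unfolding K(2) by (simp add: algebra_simps)
    finally show "(LINT t:N x \<epsilon>|lebesgue. (1 / (x - t)) *\<^sub>R f t) =
      (ln (\<delta> + (x - c)) - ln (\<delta> - (x - c))) *\<^sub>R f x - (LINT t:N x \<epsilon>|lebesgue. T x t)" .
  qed
  \<comment> \<open>The logarithmic term is constant in \<epsilon>, so passing to the limit only
    replaces \<open>N x \<epsilon>\<close> by the full interval in the integral of
    \<open>T x\<close>.\<close>
  define l where "l x = (ln (\<delta> + (x - c)) - ln (\<delta> - (x - c))) *\<^sub>R f x - (LINT t:?A|lebesgue. T x t)" for x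
  \<comment> \<open>The Taylor coefficients at 0 of ln(\<delta> + y) - ln(\<delta> - y), to be
    convolved with those of f.\<close>
  define q where "q n = (1 - (-1) ^ n) / (real n * \<delta> ^ n)" for n
  show ?thesis
  proof (rule that[of l])
    fix x assume x: "\<bar>x - c\<bar> < \<delta>"
    have "((\<lambda>\<epsilon>. LINT t:N x \<epsilon>|lebesgue. T x t) \<longlongrightarrow> (LINT t:?A|lebesgue. T x t)) (at_right 0)"
      unfolding N_def by (rule truncated_set_integral_tendsto[OF A exp(1)[OF x]])
    then have "((\<lambda>\<epsilon>. (ln (\<delta> + (x - c)) - ln (\<delta> - (x - c))) *\<^sub>R f x - (LINT t:N x \<epsilon>|lebesgue. T x t)) \<longlongrightarrow> l x) (at_right 0)"
      unfolding l_def by (intro tendsto_intros)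
    moreover have "eventually (\<lambda>\<epsilon>. (LINT t:N x \<epsilon>|lebesgue. (1 / (x - t)) *\<^sub>R f t) =
        (ln (\<delta> + (x - c)) - ln (\<delta> - (x - c))) *\<^sub>R f x - (LINT t:N x \<epsilon>|lebesgue. T x t)) (at_right 0)"
      using eventually_at_right_real[of 0 "\<delta> - \<bar>x - c\<bar>"] x
      by (auto elim!: eventually_mono intro: I(2))
    ultimately show "((\<lambda>\<epsilon>. LINT t:N x \<epsilon>|lebesgue. (1 / (x - t)) *\<^sub>R f t) \<longlongrightarrow> l x) (at_right 0)"
      by (simp cong: tendsto_cong)
    have x': "\<bar>x - c\<bar> < \<rho>" using x d by simp
    have "(\<lambda>n. (x - c) ^ n *\<^sub>R (\<Sum>i\<le>n. q i *\<^sub>R a (n - i))) sums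
        ((ln (\<delta> + (x - c)) - ln (\<delta> - (x - c))) *\<^sub>R f x)"
      using ln_ratio_power_series_sums[OF x] f[OF x'] summable_norm_power_series_tail[OF bound rho x', of 0]
      unfolding q_def by (intro Cauchy_product_power_series_sums) auto
    from sums_diff[OF this exp(2)[OF x]]
    show "(\<lambda>n. (x - c) ^ n *\<^sub>R ((\<Sum>i\<le>n. q i *\<^sub>R a (n - i)) - (LINT t:?A|lebesgue. ?h n t))) sums l x"
      by (simp add: l_def scaleR_diff_right)
  qed (use I(1) in blast)
qed

section \<open>Local expansion of the Hilbert transform and conclusion\<close>

lemma hilbert_transform_power_series:
  fixes f :: "real \<Rightarrow> 'a::{real_normed_algebra_1, euclidean_space}" and c r p :: real
  assumes p: "1 \<le> p" and f: "f \<in> Lp_functions p" and r: "r > 0"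
    and a: "\<And>t. \<bar>t - c\<bar> < r \<Longrightarrow> (\<lambda>n. (t - c) ^ n *\<^sub>R a n) sums f t"
  obtains \<delta> b where "\<delta> > 0"
    "\<And>x. \<bar>x - c\<bar> < \<delta> \<Longrightarrow> hilbert_transform_exists f x"
    "\<And>x. \<bar>x - c\<bar> < \<delta> \<Longrightarrow> (\<lambda>n. (x - c) ^ n *\<^sub>R b n) sums hilbert_transform f x"
proof -
  \<comment> \<open>The first halving puts c + \<rho> inside the disc of convergence, which yields
    the coefficient bound at radius \<rho>; the second is the one that the near part needs for the
    tail estimate.\<close>
  define \<rho> where "\<rho> = r / 2"
  define \<delta> where "\<delta> = \<rho> / 2"
  have rho: "\<rho> > 0" "\<rho> < r" and d: "\<delta> > 0" using r by (auto simp: \<rho>_def \<delta>_def)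
  have "summable (\<lambda>n. \<rho> ^ n *\<^sub>R a n)" using a[of "c + \<rho>"] rho by (auto simp: sums_iff)
  then obtain M where M: "\<And>n. norm (a n) \<le> M / \<rho> ^ n"
    using convergent_power_series_coeff_bound[OF _ rho(1)] by blast
  have a': "(\<lambda>n. (t - c) ^ n *\<^sub>R a n) sums f t" if "\<bar>t - c\<bar> < \<rho>" for t
    using a that rho by simp
  let ?K = "\<lambda>x t. (1 / (x - t)) *\<^sub>R f t"
  let ?S = "{t. \<delta> < \<bar>t - c\<bar>}"
  let ?N = "\<lambda>x \<epsilon>. {c - \<delta>..c + \<delta>} \<inter> {t. \<bar>x - t\<bar> > \<epsilon>}"
  obtain bf where far: "\<And>x. \<bar>x - c\<bar> < \<delta> \<Longrightarrow> set_integrable lebesgue ?S (?K x)"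
    "\<And>x. \<bar>x - c\<bar> < \<delta> \<Longrightarrow> (\<lambda>n. (x - c) ^ n *\<^sub>R bf n) sums (LINT t:?S|lebesgue. ?K x t)"
    by (rule far_kernel_power_series[OF p f d, of c]) (rule that)
  obtain bn l where near:
    "\<And>x \<epsilon>. \<lbrakk>\<bar>x - c\<bar> < \<delta>; 0 < \<epsilon>; \<epsilon> < \<delta> - \<bar>x - c\<bar>\<rbrakk> \<Longrightarrow> set_integrable lebesgue (?N x \<epsilon>) (?K x)"
    "\<And>x. \<bar>x - c\<bar> < \<delta> \<Longrightarrow> ((\<lambda>\<epsilon>. LINT t:?N x \<epsilon>|lebesgue. ?K x t) \<longlongrightarrow> l x) (at_right 0)"
    "\<And>x. \<bar>x - c\<bar> < \<delta> \<Longrightarrow> (\<lambda>n. (x - c) ^ n *\<^sub>R bn n) sums l x"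
    by (rule near_kernel_principal_value[OF M rho(1) a', folded \<delta>_def]) (assumption, rule that)
  define H where "H x = (1 / pi) *\<^sub>R (l x + (LINT t:?S|lebesgue. ?K x t))" for x
  have lim: "(truncated_hilbert f x \<longlongrightarrow> H x) (at_right 0)" if x: "\<bar>x - c\<bar> < \<delta>" for x
  proof -
    have split: "truncated_hilbert f x \<epsilon> =
        (1 / pi) *\<^sub>R ((LINT t:?N x \<epsilon>|lebesgue. ?K x t) + (LINT t:?S|lebesgue. ?K x t))"
      if e: "0 < \<epsilon>" "\<epsilon> < \<delta> - \<bar>x - c\<bar>" for \<epsilon>
    proof -
      \<comment> \<open>For such \<epsilon> every t with |x - t| \<le> \<epsilon> satisfies |t - c|
        < \<delta>, so the truncation leaves the far set untouched.\<close>
      have "{t. \<bar>x - t\<bar> > \<epsilon>} = ?N x \<epsilon> \<union> ?S" "?N x \<epsilon> \<inter> ?S = {}" using e by auto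
      then show ?thesis
        unfolding truncated_hilbert_def
        using set_integral_Un[OF _ near(1)[OF x e] far(1)[OF x]] by simp
    qed
    have "((\<lambda>\<epsilon>. (1 / pi) *\<^sub>R ((LINT t:?N x \<epsilon>|lebesgue. ?K x t) + (LINT t:?S|lebesgue. ?K x t)))
        \<longlongrightarrow> H x) (at_right 0)"
      unfolding H_def by (intro tendsto_intros near(2)[OF x])
    moreover have "eventually (\<lambda>\<epsilon>. truncated_hilbert f x \<epsilon> =
        (1 / pi) *\<^sub>R ((LINT t:?N x \<epsilon>|lebesgue. ?K x t) + (LINT t:?S|lebesgue. ?K x t))) (at_right 0)"
      using eventually_at_right_real[of 0 "\<delta> - \<bar>x - c\<bar>"] x
      by (auto elim!: eventually_mono intro: split)
    ultimately show ?thesis by (simp cong: tendsto_cong)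
  qed
  show ?thesis
  proof (rule that[OF d])
    fix x assume x: "\<bar>x - c\<bar> < \<delta>"
    show "hilbert_transform_exists f x"
      using lim[OF x] by (auto simp: hilbert_transform_exists_def)
    have "hilbert_transform f x = H x"
      unfolding hilbert_transform_def by (rule tendsto_Lim[OF _ lim[OF x]]) simp
    then show "(\<lambda>n. (x - c) ^ n *\<^sub>R ((1 / pi) *\<^sub>R (bn n + bf n))) sums hilbert_transform f x"
      using sums_scaleR_right[OF sums_add[OF near(3)[OF x] far(2)[OF x]], of "1 / pi"]
      by (simp add: H_def scaleR_add_right mult.commute)
  qed
qed

theorem theorem1p3:
  fixes f :: "real \<Rightarrow> 'a::{real_normed_field, euclidean_space}"
    and p x0 :: real
  assumes "1 \<le> p"
    and "f \<in> Lp_functions p"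
    and "\<exists>U. open U \<and> x0 \<in> U \<and> f real_analytic_on U"
  shows "\<exists>V. open V \<and> x0 \<in> V \<and> (\<forall>x\<in>V. hilbert_transform_exists f x)
              \<and> hilbert_transform f real_analytic_on V"
proof -
  obtain U where U: "open U" "x0 \<in> U" "f real_analytic_on U" using assms(3) by blast
  \<comment> \<open>The set \<open>U\<close> itself serves as \<open>V\<close>: each of its points
    is the centre of an expansion of f, hence of one of the transform, and the principal value
    exists in particular at that centre.\<close>
  have *: "\<exists>\<delta>>0. \<exists>b. \<forall>x\<in>ball c \<delta>. hilbert_transform_exists f x \<and>
      (\<lambda>n. (x - c) ^ n *\<^sub>R b n) sums hilbert_transform f x" if c: "c \<in> U" for c
  proof -
    obtain r a where r: "r > 0" and a: "\<And>t. t \<in> ball c r \<Longrightarrow> (\<lambda>n. (t - c) ^ n *\<^sub>R a n) sums f t"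
      using U(3) c unfolding real_analytic_on_def by blast
    obtain \<delta> b where "\<delta> > 0"
      "\<And>x. \<bar>x - c\<bar> < \<delta> \<Longrightarrow> hilbert_transform_exists f x"
      "\<And>x. \<bar>x - c\<bar> < \<delta> \<Longrightarrow> (\<lambda>n. (x - c) ^ n *\<^sub>R b n) sums hilbert_transform f x"
    proof (rule hilbert_transform_power_series[OF assms(1,2) r, of c a])
      show "(\<lambda>n. (t - c) ^ n *\<^sub>R a n) sums f t" if "\<bar>t - c\<bar> < r" for t
        using that by (intro a) (simp add: dist_real_def abs_minus_commute)
    qed (rule that)
    then show ?thesis
      by (intro exI[of _ \<delta>] exI[of _ b] conjI ballI) (simp_all add: dist_real_def abs_minus_commute)
  qed
  then have "hilbert_transform f real_analytic_on U"
    unfolding real_analytic_on_def by blast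
  moreover have "\<forall>x\<in>U. hilbert_transform_exists f x"
    using * by (meson centre_in_ball)
  ultimately show ?thesis using U by blast
qed

end
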